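(* Let $(S,E)$ be a Weyl $*$-semigroup. The coset groupoid $\mathcal{C}(S)$, with the topology generated by the sets $\mathcal{C}_a=\{C\in\mathcal{C}(S):a\in C\}$ for $a\in S$, is étale.
   Context: A $*$-semigroup is a semigroup $S$ with a unary operation $a\mapsto a^*$ satisfying $a^{**}=a$ and $(ab)^*=b^*a^*$. For $T,U\subseteq S$: $TU=\{tu:t\in T,u\in U\}$, $T^*=\{t^*:t\in T\}$. A Weyl $*$-semigroup $(S,E)$ is a $*$-semigroup $S$ with a subset $E$ such that $EE\subseteq E=E^*$, $a^*Ea\subseteq E$ for all $a\in S$, and for every $a\in S$ the element $a^*a$ lies in $E$ and commutes with every element of $E$. For $a,b\in S$: $a\precsim b$ iff $ab^*\in E$ and $a=ab^*b$. For $T\subseteq S$, $T^{\precsim}=\{a\in S:\exists t\in T\ (t\precsim a)\}$. A coset is a subset $C\subseteq S$ with $CC^*C\subseteq C=C^{\precsim}$. The set $\mathcal{C}(S)$ of non-empty cosets is a groupoid with inverse $C\mapsto C^*$ and product $(B,C)\mapsto(BC)^{\precsim}$, defined when $(B^*B)^{\precsim}=(CC^* )^{\precsim}$. The sets $\mathcal{C}_a$ are taken as a subbasis of the topology. A topological groupoid (one with continuous inverse and product) is étale if the product is an open map and the set of units is open; equivalently, the source map, regarded as a map from the groupoid to itself, is open (and hence a local homeomorphism). *)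

theory Defs
  imports "HOL-Analysis.Analysis" "HOL-Library.Set_Algebras"
begin

section \<open>Weyl *-semigroups\<close>

class star_semigroup = semigroup_mult +
  fixes star :: "'a \<Rightarrow> 'a"
  assumes star_star: "star (star a) = a"
    and star_mult: "star (a * b) = star b * star a"

text \<open>The product \<open>T * U\<close> of two subsets is the elementwise one of \<^theory>\<open>HOL-Library.Set_Algebras\<close>.\<close>

abbreviation set_star :: "'a::star_semigroup set \<Rightarrow> 'a set" where
  "set_star T \<equiv> star ` T"

locale weyl_star_semigroup =
  fixes E :: "'a::star_semigroup set"
  assumes E_mult: "E * E \<subseteq> E"
    and E_star: "E = set_star E"
    and E_conj: "{star a} * E * {a} \<subseteq> E"
    and star_mult_self_in_E: "star a * a \<in> E"
    and star_mult_self_commutes: "e \<in> E \<Longrightarrow> star a * a * e = e * (star a * a)"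

definition below :: "'a::star_semigroup set \<Rightarrow> 'a \<Rightarrow> 'a \<Rightarrow> bool" where
  "below E a b \<longleftrightarrow> a * star b \<in> E \<and> a = a * star b * b"

definition up :: "'a::star_semigroup set \<Rightarrow> 'a set \<Rightarrow> 'a set" where
  "up E T = {a. \<exists>t\<in>T. below E t a}"

section \<open>Cosets\<close>

definition coset :: "'a::star_semigroup set \<Rightarrow> 'a set \<Rightarrow> bool" where
  "coset E C \<longleftrightarrow> C * set_star C * C \<subseteq> C \<and> C = up E C"

definition nonempty_cosets :: "'a::star_semigroup set \<Rightarrow> 'a set set" where
  "nonempty_cosets E = {C. coset E C \<and> C \<noteq> {}}"

definition coset_composable :: "'a::star_semigroup set \<Rightarrow> ('a set \<times> 'a set) set" where
  "coset_composable E =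
     {(B, C). B \<in> nonempty_cosets E \<and> C \<in> nonempty_cosets E \<and>
        up E (set_star B * B) = up E (C * set_star C)}"

definition coset_mult :: "'a::star_semigroup set \<Rightarrow> 'a set \<Rightarrow> 'a set \<Rightarrow> 'a set" where
  "coset_mult E B C = up E (B * C)"

definition coset_topology :: "'a::star_semigroup set \<Rightarrow> 'a set topology" where
  "coset_topology E =
     topology_generated_by (range (\<lambda>a. {C \<in> nonempty_cosets E. a \<in> C}))"

section \<open>Groupoids\<close>

text \<open>
  A groupoid is given by its set of arrows \<open>G\<close>, the set \<open>G2\<close> of composable pairs, a product
  that is only meaningful on \<open>G2\<close>, and an inverse. A pair \<open>(g, h)\<close> is composable when the
  source of \<open>g\<close> is the range of \<open>h\<close>; units are identified with their identity arrows.
\<close>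

locale groupoid =
  fixes G :: "'g set"
    and G2 :: "('g \<times> 'g) set"
    and m :: "'g \<Rightarrow> 'g \<Rightarrow> 'g"
    and i :: "'g \<Rightarrow> 'g"
  assumes composable_subset: "G2 \<subseteq> G \<times> G"
    and m_closed: "(g, h) \<in> G2 \<Longrightarrow> m g h \<in> G"
    and i_closed: "g \<in> G \<Longrightarrow> i g \<in> G"
    and i_i: "g \<in> G \<Longrightarrow> i (i g) = g"
    and assoc_composable_left: "\<lbrakk>(g, h) \<in> G2; (h, k) \<in> G2\<rbrakk> \<Longrightarrow> (m g h, k) \<in> G2"
    and assoc_composable_right: "\<lbrakk>(g, h) \<in> G2; (h, k) \<in> G2\<rbrakk> \<Longrightarrow> (g, m h k) \<in> G2"
    and assoc: "\<lbrakk>(g, h) \<in> G2; (h, k) \<in> G2\<rbrakk> \<Longrightarrow> m (m g h) k = m g (m h k)"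
    and i_composable: "g \<in> G \<Longrightarrow> (i g, g) \<in> G2"
    and cancel_left: "(g, h) \<in> G2 \<Longrightarrow> m (i g) (m g h) = h"
    and cancel_right: "(g, h) \<in> G2 \<Longrightarrow> m (m g h) (i h) = g"
begin

definition units :: "'g set" where
  "units = (\<lambda>g. m (i g) g) ` G"

end

locale topological_groupoid = groupoid G G2 m i
  for G :: "'g set" and G2 m i +
  fixes X :: "'g topology"
  assumes topspace_eq: "topspace X = G"
    and continuous_inverse: "continuous_map X X i"
    and continuous_product:
      "continuous_map (subtopology (prod_topology X X) G2) X (\<lambda>(g, h). m g h)"

locale etale_groupoid = topological_groupoid G G2 m i X
  for G :: "'g set" and G2 m i X +
  assumes open_product: "open_map (subtopology (prod_topology X X) G2) X (\<lambda>(g, h). m g h)"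
    and open_units: "openin X units"

end

theory Submission
  imports Defs
begin

text \<open>
  Call a set \<open>T\<close> round if \<open>T \<subseteq> T\<^sup>\<precsim>\<close>. The order is transitive and compatible with product and star, so
  on round sets \<open>T \<mapsto> T\<^sup>\<precsim>\<close> is a closure operator with \<open>(T\<^sup>\<precsim> U)\<^sup>\<precsim> = (T U)\<^sup>\<precsim> = (T U\<^sup>\<precsim>)\<^sup>\<precsim>\<close>. Hence the
  closed round sets form a *-semigroup under \<open>T \<cdot> U = (T U)\<^sup>\<precsim>\<close>, and the cosets are among its
  partial isometries, \<open>C \<cdot> C\<^sup>* \<cdot> C = C\<close> (lemma \<open>up_coset_triple\<close>). Two cosets are composable when
  \<open>B\<^sup>* \<cdot> B = C \<cdot> C\<^sup>*\<close>, and the groupoid laws become short calculations in this *-semigroup.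

  Write \<open>\<C>\<^sub>a\<close> for the set of non-empty cosets containing \<open>a\<close>. Membership of \<open>a\<close> in \<open>B\<^sup>*\<close> or in \<open>B \<cdot> C\<close> is
  witnessed by a single element of each factor, so inverse and product are continuous. A non-empty
  coset is a unit exactly when it meets \<open>E\<close>, so the units are the open set \<open>\<Union>e\<in>E. \<C>\<^sub>e\<close>.

  The product is open because the source map has enough continuous local sections. Given \<open>B\<close>, pick
  \<open>b\<^sub>0 \<precsim> b\<close> in \<open>B\<close>. The element \<open>b\<^sub>0 b\<^sup>*\<close> lies in \<open>E\<close>, so the open set \<open>\<C>\<^sub>a\<close> with \<open>a = b\<^sub>0 b\<^sup>*\<close>
  consists of units, and it contains the range \<open>B \<cdot> B\<^sup>*\<close> of \<open>B\<close>. On it, \<open>R \<mapsto> (b\<^sup>* R)\<^sup>\<precsim>\<close> is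
  continuous, takes values in cosets with source \<open>R\<close>, and sends \<open>B \<cdot> B\<^sup>*\<close> to \<open>B\<^sup>*\<close> (lemmas
  \<open>section_coset\<close>, \<open>section_source\<close>, \<open>section_range\<close>). If \<open>s\<close> is such a section, then
  \<open>D \<mapsto> (s(D D\<^sup>*)\<^sup>*, s(D D\<^sup>*) D)\<close> is a continuous right inverse of the product, defined near \<open>B \<cdot> C\<close>
  and taking the value \<open>(B, C)\<close> there, and a map with a continuous local right inverse through every
  point of its domain is open. The last step holds in any topological groupoid
  (lemma \<open>open_map_product_if_local_sections\<close>).
\<close>

section \<open>The order of a Weyl *-semigroup\<close>

context weyl_star_semigroup
begin

lemma mult_in_E: "e \<in> E \<Longrightarrow> f \<in> E \<Longrightarrow> e * f \<in> E"
  using E_mult set_times_intro by blast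

lemma star_in_E: "e \<in> E \<Longrightarrow> star e \<in> E"
  using E_star by blast

lemma conj_in_E: "e \<in> E \<Longrightarrow> star a * e * a \<in> E"
  using E_conj by (meson set_times_intro singletonI subsetD)

lemma conj_star_in_E: "e \<in> E \<Longrightarrow> a * e * star a \<in> E"
  using conj_in_E[of e "star a"] by (simp add: star_star)

lemma mult_star_self_in_E: "a * star a \<in> E"
  using star_mult_self_in_E[of "star a"] by (simp add: star_star)

lemma mult_star_self_commutes: "e \<in> E \<Longrightarrow> a * star a * e = e * (a * star a)"
  using star_mult_self_commutes[of e "star a"] by (simp add: star_star)

lemma below_trans:
  assumes "below E a b" "below E b c"
  shows "below E a c"
proof -
  have a: "a * star b * b = a" "a * star b \<in> E" and b: "b * star c * c = b" "b * star c \<in> E"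
    using assms by (auto simp: below_def)
  have "a * star c * c = a * star b * (b * star c * c)"
    by (subst a(1)[symmetric]) (simp add: mult.assoc)
  then have "a * star c * c = a"
    using a(1) b(1) by simp
  moreover have "a * star c = (a * star b) * (b * star c)"
    by (subst a(1)[symmetric]) (simp add: mult.assoc)
  ultimately show ?thesis
    using mult_in_E[OF a(2) b(2)] by (simp add: below_def)
qed

text \<open>
  The middle factor \<open>b b'\<^sup>*\<close> of \<open>a b (a' b')\<^sup>*\<close> lies in \<open>E\<close>: conjugating it by \<open>a'\<close> stays in \<open>E\<close>, and it
  commutes with \<open>a'\<^sup>* a'\<close>, which lets \<open>a\<close> and \<open>b\<close> be restored separately.
\<close>

lemma below_mult:
  assumes "below E a a'" "below E b b'"
  shows "below E (a * b) (a' * b')"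
proof -
  have a: "a * star a' * a' = a" "a * star a' \<in> E" and b: "b * star b' * b' = b" "b * star b' \<in> E"
    using assms by (auto simp: below_def)
  have "a * b * star (a' * b') = (a * star a') * (a' * (b * star b') * star a')"
    by (subst a(1)[symmetric]) (simp add: mult.assoc star_mult)
  then have *: "a * b * star (a' * b') \<in> E"
    using mult_in_E[OF a(2) conj_star_in_E[OF b(2)]] by simp
  have "a * b * star (a' * b') * (a' * b') = a * ((b * star b') * (star a' * a')) * b'"
    by (simp add: mult.assoc star_mult)
  also have "\<dots> = a * ((star a' * a') * (b * star b')) * b'"
    using star_mult_self_commutes[OF b(2)] by simp
  also have "\<dots> = (a * star a' * a') * (b * star b' * b')"
    by (simp add: mult.assoc)
  finally show ?thesis
    using * a(1) b(1) by (simp add: below_def)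
qed

lemma below_star:
  assumes "below E a b"
  shows "below E (star a) (star b)"
proof -
  have a: "a * star b * b = a" "a * star b \<in> E"
    using assms by (auto simp: below_def)
  have s: "star b * (b * star a) = star a"
    using arg_cong[OF a(1), of star] by (simp add: star_mult star_star)
  have e: "b * star a \<in> E"
    using star_in_E[OF a(2)] by (simp add: star_mult star_star)
  have "star a * b = star b * (b * star a) * b"
    by (simp only: s)
  then have *: "star a * b \<in> E"
    using conj_in_E[OF e] by simp
  have "star a * b * star b = star b * ((b * star a) * (b * star b))"
    by (subst s[symmetric]) (simp add: mult.assoc)
  also have "\<dots> = star b * ((b * star b) * (b * star a))"
    using mult_star_self_commutes[OF e] by simp
  also have "\<dots> = star b * (b * (star b * (b * star a)))"
    by (simp only: mult.assoc)
  also have "\<dots> = star a"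
    by (simp only: s)
  finally show ?thesis
    using * by (simp add: below_def star_star)
qed

text \<open>
  Since \<open>x \<precsim> x\<close> can fail, so can \<open>e x \<precsim> x\<close>; passing to some \<open>t \<precsim> x\<close> before multiplying by \<open>e\<close>
  repairs this.
\<close>

lemma below_left_multiple:
  assumes "e \<in> E" "below E t x"
  shows "below E (e * t) x"
proof -
  have t: "t * star x * x = t" "t * star x \<in> E"
    using assms(2) by (auto simp: below_def)
  have "e * t * star x \<in> E"
    using mult_in_E[OF assms(1) t(2)] by (simp add: mult.assoc)
  moreover have "e * t = e * t * star x * x"
    using t(1) by (simp add: mult.assoc)
  ultimately show ?thesis
    by (simp add: below_def)
qed

lemma below_star_factor:
  assumes "below E t b"
  shows "star b * (b * star t) = star t"
proof -
  have "star t = star (t * star b * b)"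
    using assms by (simp add: below_def)
  then show ?thesis
    by (simp add: star_mult star_star)
qed

section \<open>Round sets and their upward closures\<close>

text \<open>
  The sets on which \<open>up\<close> behaves like a closure operator, although the order is not reflexive.
\<close>

definition round_set :: "'a set \<Rightarrow> bool" where
  "round_set T \<longleftrightarrow> T \<subseteq> up E T"

lemma up_mono: "T \<subseteq> U \<Longrightarrow> up E T \<subseteq> up E U"
  by (auto simp: up_def)

lemma up_up_subset: "up E (up E T) \<subseteq> up E T"
  by (auto simp: up_def intro: below_trans)

lemma up_least: "T \<subseteq> up E U \<Longrightarrow> up E T \<subseteq> up E U"
  using up_mono up_up_subset by blast

lemma up_up: "round_set T \<Longrightarrow> up E (up E T) = up E T"
  by (simp add: round_set_def up_mono up_up_subset subset_antisym)

lemma round_up: "round_set T \<Longrightarrow> round_set (up E T)"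
  by (simp add: round_set_def up_mono)

lemma up_mult_up_subset: "up E T * up E U \<subseteq> up E (T * U)"
  unfolding up_def by (auto elim!: set_times_elim intro!: below_mult)

lemma up_triple_subset: "up E T * up E U * up E V \<subseteq> up E (T * U * V)"
  by (rule subset_trans[OF set_times_mono2[OF up_mult_up_subset subset_refl] up_mult_up_subset])

lemma mem_up_mult: "a \<in> up E (T * U) \<longleftrightarrow> (\<exists>t\<in>T. \<exists>u\<in>U. below E (t * u) a)"
  unfolding up_def by (blast elim: set_times_elim intro: set_times_intro)

lemma round_mult: "round_set T \<Longrightarrow> round_set U \<Longrightarrow> round_set (T * U)"
  using up_mult_up_subset set_times_mono2 unfolding round_set_def by (meson subset_trans)

lemma up_mult_up_left:
  assumes "round_set T" "round_set U"
  shows "up E (up E T * U) = up E (T * U)"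
proof
  show "up E (up E T * U) \<subseteq> up E (T * U)"
    using assms(2) up_mult_up_subset[of T U] set_times_mono2[of "up E T" "up E T" U "up E U"]
    by (intro up_least) (auto simp: round_set_def)
  show "up E (T * U) \<subseteq> up E (up E T * U)"
    using assms(1) by (intro up_mono set_times_mono2) (auto simp: round_set_def)
qed

lemma up_mult_up_right:
  assumes "round_set T" "round_set U"
  shows "up E (T * up E U) = up E (T * U)"
proof
  show "up E (T * up E U) \<subseteq> up E (T * U)"
    using assms(1) up_mult_up_subset[of T U] set_times_mono2[of T "up E T" "up E U" "up E U"]
    by (intro up_least) (auto simp: round_set_def)
  show "up E (T * U) \<subseteq> up E (T * up E U)"
    using assms(2) by (intro up_mono set_times_mono2) (auto simp: round_set_def)
qed

lemma set_star_star: "set_star (set_star T) = (T :: 'a set)"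
  by (simp add: image_image star_star)

lemma set_star_mult: "set_star (T * U) = set_star U * set_star (T :: 'a set)"
proof (intro equalityI subsetI)
  fix x assume "x \<in> set_star (T * U)"
  then show "x \<in> set_star U * set_star T"
    by (auto elim!: set_times_elim intro!: set_times_intro simp: star_mult)
next
  fix x assume "x \<in> set_star U * set_star T"
  then obtain t u where "t \<in> T" "u \<in> U" "x = star u * star t"
    by (auto elim!: set_times_elim)
  then show "x \<in> set_star (T * U)"
    by (metis imageI set_times_intro star_mult)
qed

lemma set_star_up: "set_star (up E T) = up E (set_star T)"
proof (intro equalityI subsetI)
  fix x assume "x \<in> set_star (up E T)"
  then show "x \<in> up E (set_star T)"
    by (auto simp: up_def intro: below_star)
next
  fix x assume "x \<in> up E (set_star T)"
  then obtain t where "t \<in> T" "below E (star t) x"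
    by (auto simp: up_def)
  then have "star x \<in> up E T"
    using below_star[of "star t" x] by (auto simp: up_def star_star)
  then show "x \<in> set_star (up E T)"
    by (metis imageI star_star)
qed

lemma round_star: "round_set T \<Longrightarrow> round_set (set_star T)"
  unfolding round_set_def by (metis image_mono set_star_up)

section \<open>Groupoid structure on the non-empty cosets\<close>

lemma nonempty_cosetsI:
  "C * set_star C * C \<subseteq> C \<Longrightarrow> up E C = C \<Longrightarrow> C \<noteq> {} \<Longrightarrow> C \<in> nonempty_cosets E"
  by (simp add: nonempty_cosets_def coset_def)

context
  fixes C
  assumes C: "C \<in> nonempty_cosets E"
begin

lemma up_coset: "up E C = C"
  using C by (simp add: nonempty_cosets_def coset_def)

lemma coset_triple_subset: "C * set_star C * C \<subseteq> C"
  using C by (simp add: nonempty_cosets_def coset_def)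

lemma coset_nonempty: "C \<noteq> {}"
  using C by (simp add: nonempty_cosets_def)

lemma round_coset: "round_set C"
  by (simp add: round_set_def up_coset)

lemma round_star_coset: "round_set (set_star C)"
  by (rule round_star[OF round_coset])

lemma coset_triple: "a \<in> C \<Longrightarrow> b \<in> C \<Longrightarrow> c \<in> C \<Longrightarrow> a * star b * c \<in> C"
  using coset_triple_subset by (meson imageI set_times_intro subsetD)

lemma coset_upward: "t \<in> C \<Longrightarrow> below E t c \<Longrightarrow> c \<in> C"
  using up_coset by (auto simp: up_def)

lemma coset_below: "c \<in> C \<Longrightarrow> \<exists>t\<in>C. below E t c"
  using up_coset by (auto simp: up_def)

text \<open>
  A coset is a partial isometry: \<open>t \<precsim> c\<close> in \<open>C\<close> says in particular that \<open>t = t c\<^sup>* c\<close> is a triple product.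
\<close>

lemma up_coset_triple: "up E (C * set_star C * C) = C"
proof
  show "up E (C * set_star C * C) \<subseteq> C"
    using up_mono[OF coset_triple_subset] up_coset by simp
  show "C \<subseteq> up E (C * set_star C * C)"
  proof
    fix c assume c: "c \<in> C"
    then obtain t where t: "t \<in> C" "below E t c"
      using coset_below by blast
    then have "t * star c * c \<in> C * set_star C * C"
      using c by (intro set_times_intro) auto
    moreover have "t * star c * c = t"
      using t by (simp add: below_def)
    ultimately show "c \<in> up E (C * set_star C * C)"
      using t by (auto simp: up_def)
  qed
qed

lemma coset_star: "set_star C \<in> nonempty_cosets E"
proof (rule nonempty_cosetsI)
  show "set_star C * set_star (set_star C) * set_star C \<subseteq> set_star C"
    using image_mono[OF coset_triple_subset, of star]
    by (simp add: set_star_mult set_star_star mult.assoc)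
  show "up E (set_star C) = set_star C"
    by (metis set_star_up up_coset)
  show "set_star C \<noteq> {}"
    using coset_nonempty by simp
qed

end

lemmas round_simps = round_coset round_star_coset round_mult round_up

context
  fixes B C
  assumes BC: "(B, C) \<in> coset_composable E"
begin

lemma composable_cosets: "B \<in> nonempty_cosets E" "C \<in> nonempty_cosets E"
  using BC by (auto simp: coset_composable_def)

lemma composable_eq: "up E (set_star B * B) = up E (C * set_star C)"
  using BC by (auto simp: coset_composable_def)

lemma composable_cancel_left: "up E (set_star B * B * C) = C"
proof -
  note BC' = composable_cosets
  have "up E (set_star B * B * C) = up E (up E (set_star B * B) * C)"
    by (simp add: up_mult_up_left round_simps BC')
  also have "\<dots> = up E (C * set_star C * C)"
    by (simp add: composable_eq up_mult_up_left round_simps BC')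
  finally show ?thesis
    by (simp add: up_coset_triple BC')
qed

lemma composable_cancel_right: "up E (B * (C * set_star C)) = B"
proof -
  note BC' = composable_cosets
  have "up E (B * (C * set_star C)) = up E (B * up E (C * set_star C))"
    by (simp add: up_mult_up_right round_simps BC')
  also have "\<dots> = up E (B * (set_star B * B))"
    by (simp add: composable_eq[symmetric] up_mult_up_right round_simps BC')
  finally show ?thesis
    using up_coset_triple[OF BC'(1)] by (simp add: mult.assoc)
qed

text \<open>
  In \<open>B C C\<^sup>* B\<^sup>* B C\<close> the factors \<open>C C\<^sup>*\<close> and \<open>B\<^sup>* B\<close> are absorbed by the outer \<open>B\<close> and \<open>C\<close>, since
  composability makes them equal up to closure.
\<close>

lemma composable_mult_coset: "up E (B * C) \<in> nonempty_cosets E"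
proof (rule nonempty_cosetsI)
  note BC' = composable_cosets
  have r: "round_set (B * C)" "round_set (set_star C * set_star B)"
    by (simp_all add: round_simps BC')
  show "up E (up E (B * C)) = up E (B * C)"
    by (rule up_up[OF r(1)])
  have "up E (B * C) * set_star (up E (B * C)) * up E (B * C)
      \<subseteq> up E (B * C * (set_star C * set_star B) * (B * C))"
    unfolding set_star_up set_star_mult by (rule up_triple_subset)
  also have "B * C * (set_star C * set_star B) * (B * C)
      = (B * (C * set_star C)) * (set_star B * B * C)"
    by (simp add: mult.assoc)
  also have "up E \<dots> = up E (up E (B * (C * set_star C)) * up E (set_star B * B * C))"
    by (simp add: up_mult_up_left up_mult_up_right round_simps BC')
  also have "\<dots> = up E (B * C)"
    by (simp only: composable_cancel_left composable_cancel_right)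
  finally show "up E (B * C) * set_star (up E (B * C)) * up E (B * C) \<subseteq> up E (B * C)" .
  show "up E (B * C) \<noteq> {}"
  proof -
    obtain b c where "b \<in> B" "c \<in> C"
      using coset_nonempty BC' by blast
    then have "b * c \<in> B * C"
      by (rule set_times_intro)
    then show ?thesis
      using r(1) unfolding round_set_def by blast
  qed
qed

lemma composable_mult_source:
  "up E (set_star (up E (B * C)) * up E (B * C)) = up E (set_star C * C)"
proof -
  note BC' = composable_cosets
  have "up E (set_star (up E (B * C)) * up E (B * C))
      = up E (set_star C * (set_star B * B * C))"
    by (simp add: set_star_up set_star_mult up_mult_up_left up_mult_up_right round_simps BC'
        mult.assoc)
  also have "\<dots> = up E (set_star C * up E (set_star B * B * C))"
    by (simp add: up_mult_up_right round_simps BC')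
  finally show ?thesis
    by (simp only: composable_cancel_left)
qed

lemma composable_mult_range:
  "up E (up E (B * C) * set_star (up E (B * C))) = up E (B * set_star B)"
proof -
  note BC' = composable_cosets
  have "up E (up E (B * C) * set_star (up E (B * C)))
      = up E (B * (C * set_star C) * set_star B)"
    by (simp add: set_star_up set_star_mult up_mult_up_left up_mult_up_right round_simps BC'
        mult.assoc)
  also have "\<dots> = up E (up E (B * (C * set_star C)) * set_star B)"
    by (simp add: up_mult_up_left round_simps BC')
  finally show ?thesis
    by (simp only: composable_cancel_right)
qed

end

lemma groupoid_cosets:
  "groupoid (nonempty_cosets E) (coset_composable E) (coset_mult E) set_star"
proof
  show "coset_composable E \<subseteq> nonempty_cosets E \<times> nonempty_cosets E"
    by (auto simp: coset_composable_def)
  show "set_star g \<in> nonempty_cosets E" if "g \<in> nonempty_cosets E" for g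
    by (rule coset_star[OF that])
  show "set_star (set_star g) = g" for g :: "'a set"
    by (rule set_star_star)
  show "(set_star g, g) \<in> coset_composable E" if "g \<in> nonempty_cosets E" for g
    using that by (simp add: coset_composable_def coset_star set_star_star)
next
  fix g h assume gh: "(g, h) \<in> coset_composable E"
  note cosets = composable_cosets[OF gh]
  show "coset_mult E g h \<in> nonempty_cosets E"
    unfolding coset_mult_def by (rule composable_mult_coset[OF gh])
  show "coset_mult E (set_star g) (coset_mult E g h) = h"
    using composable_cancel_left[OF gh]
    by (simp add: coset_mult_def up_mult_up_right round_simps cosets mult.assoc)
  show "coset_mult E (coset_mult E g h) (set_star h) = g"
    using composable_cancel_right[OF gh]
    by (simp add: coset_mult_def up_mult_up_left round_simps cosets mult.assoc)
next
  fix g h k assume gh: "(g, h) \<in> coset_composable E" and hk: "(h, k) \<in> coset_composable E"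
  note cosets = composable_cosets[OF gh] composable_cosets[OF hk]
  show "(coset_mult E g h, k) \<in> coset_composable E"
    using composable_mult_coset[OF gh] composable_mult_source[OF gh] composable_eq[OF hk] cosets
    by (simp add: coset_composable_def coset_mult_def)
  show "(g, coset_mult E h k) \<in> coset_composable E"
    using composable_mult_coset[OF hk] composable_mult_range[OF hk] composable_eq[OF gh] cosets
    by (simp add: coset_composable_def coset_mult_def)
  show "coset_mult E (coset_mult E g h) k = coset_mult E g (coset_mult E h k)"
    by (simp add: coset_mult_def up_mult_up_left up_mult_up_right round_simps cosets mult.assoc)
qed

section \<open>Units\<close>

text \<open>
  If \<open>e \<in> C \<inter> E\<close>, then left multiplication by \<open>e\<close> or \<open>e\<^sup>*\<close> preserves being below a given element. It
  turns \<open>t \<in> C\<close> into \<open>e\<^sup>* t \<in> C\<^sup>* C\<close>, and \<open>c\<^sup>* d \<in> C\<^sup>* C\<close> into the triple product \<open>e c\<^sup>* d \<in> C\<close>.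
\<close>

lemma coset_eq_source_if_meets_E:
  assumes C: "C \<in> nonempty_cosets E" and e: "e \<in> C" "e \<in> E"
  shows "up E (set_star C * C) = C"
proof (intro equalityI subsetI)
  fix x assume "x \<in> C"
  then obtain t where t: "t \<in> C" "below E t x"
    using coset_below[OF C] by blast
  then have "below E (star e * t) x"
    using below_left_multiple star_in_E e by blast
  then show "x \<in> up E (set_star C * C)"
    using t e by (auto simp: up_def)
next
  fix x assume "x \<in> up E (set_star C * C)"
  then obtain c d where cd: "c \<in> C" "d \<in> C" "below E (star c * d) x"
    by (auto simp: up_def elim!: set_times_elim)
  have "e * star c * d \<in> C"
    by (rule coset_triple[OF C e(1) cd(1,2)])
  moreover have "below E (e * star c * d) x"
    using below_left_multiple[OF e(2) cd(3)] by (simp add: mult.assoc)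
  ultimately show "x \<in> C"
    by (rule coset_upward[OF C])
qed

lemma source_meets_E:
  assumes C: "C \<in> nonempty_cosets E"
  shows "\<exists>e\<in>E. e \<in> up E (set_star C * C)"
proof -
  obtain c where c: "c \<in> C"
    using coset_nonempty[OF C] by blast
  then obtain t where "t \<in> C" "below E t c"
    using coset_below[OF C] by blast
  then have "star c * c \<in> up E (set_star C * C)"
    unfolding up_def by (auto intro!: bexI[of _ "star t * t"] below_mult below_star)
  then show ?thesis
    using star_mult_self_in_E by blast
qed

lemma coset_units:
  "groupoid.units (nonempty_cosets E) (coset_mult E) set_star
    = (\<Union>e\<in>E. {C \<in> nonempty_cosets E. e \<in> C})"
proof -
  interpret groupoid "nonempty_cosets E" "coset_composable E" "coset_mult E" set_star
    by (rule groupoid_cosets)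
  show ?thesis
  proof (intro equalityI subsetI)
    fix U assume "U \<in> units"
    then obtain C where C: "C \<in> nonempty_cosets E" "U = up E (set_star C * C)"
      by (auto simp: units_def coset_mult_def)
    then have "U \<in> nonempty_cosets E"
      using m_closed[OF i_composable] by (simp add: coset_mult_def)
    then show "U \<in> (\<Union>e\<in>E. {C \<in> nonempty_cosets E. e \<in> C})"
      using source_meets_E[OF C(1)] C(2) by blast
  next
    fix U assume "U \<in> (\<Union>e\<in>E. {C \<in> nonempty_cosets E. e \<in> C})"
    then have U: "U \<in> nonempty_cosets E" "up E (set_star U * U) = U"
      using coset_eq_source_if_meets_E by auto
    show "U \<in> units"
      unfolding units_def coset_mult_def
      by (rule image_eqI[where x = U]) (simp_all only: U)
  qed
qed

section \<open>Local sections of the source map\<close>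

text \<open>
  For a unit \<open>R\<close> and suitable \<open>b\<close> this is the coset with source \<open>R\<close> that contains \<open>b\<^sup>*\<close>, just as a left
  coset of a subgroup is determined by the subgroup and a representative. The starred convention
  makes \<open>b \<in> B\<close> yield the coset \<open>B\<^sup>*\<close>, which is what the openness argument needs.
\<close>

definition coset_section :: "'a \<Rightarrow> 'a set \<Rightarrow> 'a set" where
  "coset_section b R = up E ({star b} * R)"

text \<open>
  The condition \<open>b\<^sub>0 b\<^sup>* \<in> R\<close> is a basic open one, and because \<open>b\<^sub>0 b\<^sup>* \<in> E\<close> it makes \<open>R\<close> a unit.
  It also gives \<open>b b\<^sup>* \<in> R\<close>, as \<open>b\<^sub>0 b\<^sup>* \<precsim> b b\<^sup>*\<close>, and by taking stars \<open>b b\<^sub>0\<^sup>* \<in> R\<close>; the latter makes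
  \<open>b\<^sup>* R\<close> round although the singleton \<open>{b\<^sup>*}\<close> need not be.
\<close>

context
  fixes b b0 R
  assumes b: "below E b0 b" and R: "R \<in> nonempty_cosets E" and bR: "b0 * star b \<in> R"
begin

lemma below_mult_star_in_E: "b0 * star b \<in> E"
  using b by (simp add: below_def)

lemma unit_source: "up E (set_star R * R) = R"
  by (rule coset_eq_source_if_meets_E[OF R bR below_mult_star_in_E])

lemma unit_star: "set_star R = R"
proof -
  have "set_star (up E (set_star R * R)) = up E (set_star R * R)"
    by (simp add: set_star_up set_star_mult set_star_star)
  then show ?thesis
    by (simp add: unit_source)
qed

lemma unit_up_mult: "up E (R * R) = R"
  using unit_source by (simp add: unit_star)

lemma unit_mult: "r \<in> R \<Longrightarrow> r' \<in> R \<Longrightarrow> r * r' \<in> R"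
  using round_mult[OF round_coset[OF R] round_coset[OF R]] unit_up_mult
  unfolding round_set_def by (metis set_times_intro subsetD)

lemma star_below_mult_in_unit: "b * star b0 \<in> R"
proof -
  have "star (b0 * star b) \<in> set_star R"
    using bR by blast
  then show ?thesis
    by (simp add: unit_star star_mult star_star)
qed

lemma mult_star_in_unit: "b * star b \<in> R"
proof -
  have b0: "b0 * star b * b = b0"
    using b by (simp add: below_def)
  have "b0 * star b * star (b * star b) * (b * star b)
      = (b0 * star b * b) * star b * b * star b"
    by (simp add: star_mult star_star mult.assoc)
  also have "\<dots> = b0 * star b"
    by (simp add: b0)
  finally have "below E (b0 * star b) (b * star b)"
    using mult_in_E[OF below_mult_star_in_E mult_star_self_in_E[of b]]
    by (simp add: below_def star_mult star_star)
  then show ?thesis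
    by (rule coset_upward[OF R bR])
qed

text \<open>
  A candidate below \<open>b\<^sup>* r\<close> is \<open>b\<^sub>0\<^sup>* r'\<close> with \<open>r' \<precsim> r\<close> in \<open>R\<close>. It belongs to \<open>b\<^sup>* R\<close> because
  \<open>b\<^sub>0\<^sup>* = b\<^sup>* (b b\<^sub>0\<^sup>*)\<close> and \<open>b b\<^sub>0\<^sup>* \<in> R\<close>.
\<close>

lemma round_section: "round_set ({star b} * R)"
  unfolding round_set_def
proof
  fix x assume "x \<in> {star b} * R"
  then obtain r where r: "r \<in> R" "x = star b * r"
    by (auto elim!: set_times_elim)
  then obtain r' where r': "r' \<in> R" "below E r' r"
    using coset_below[OF R] by blast
  have "star b * (b * star b0 * r') \<in> {star b} * R"
    by (intro set_times_intro unit_mult star_below_mult_in_unit r') simp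
  then have "star b0 * r' \<in> {star b} * R"
    using below_star_factor[OF b] by (metis mult.assoc)
  moreover have "below E (star b0 * r') x"
    unfolding r(2) by (intro below_mult below_star b r')
  ultimately show "x \<in> up E ({star b} * R)"
    by (auto simp: up_def)
qed

lemma section_coset: "coset_section b R \<in> nonempty_cosets E"
proof (rule nonempty_cosetsI)
  show "up E (coset_section b R) = coset_section b R"
    unfolding coset_section_def by (rule up_up[OF round_section])
  have "star b * (b0 * star b) \<in> {star b} * R"
    using bR by (intro set_times_intro) simp_all
  then show "coset_section b R \<noteq> {}"
    using round_section unfolding coset_section_def round_set_def by blast
  have sub: "{star b} * R * (R * {b}) * ({star b} * R) \<subseteq> {star b} * R"
  proof
    fix x assume "x \<in> {star b} * R * (R * {b}) * ({star b} * R)"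
    then obtain p q r where "p \<in> R" "q \<in> R" "r \<in> R" "x = star b * p * (q * b) * (star b * r)"
      by (auto elim!: set_times_elim)
    then have "x = star b * (p * q * (b * star b) * r)" "p * q * (b * star b) * r \<in> R"
      by (simp_all add: mult.assoc[of _ _ b] unit_mult mult_star_in_unit) (simp add: mult.assoc)
    then show "x \<in> {star b} * R"
      using set_times_intro[of "star b" "{star b}" _ R] by simp
  qed
  have "coset_section b R * set_star (coset_section b R) * coset_section b R
      \<subseteq> up E ({star b} * R * (R * {b}) * ({star b} * R))"
    using up_triple_subset[of "{star b} * R" "R * {b}" "{star b} * R"]
    by (simp add: coset_section_def set_star_up set_star_mult unit_star star_star)
  also have "\<dots> \<subseteq> coset_section b R"
    unfolding coset_section_def by (rule up_mono[OF sub])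
  finally show "coset_section b R * set_star (coset_section b R) * coset_section b R
      \<subseteq> coset_section b R" .
qed

text \<open>
  The source is the closure of \<open>R b b\<^sup>* R\<close>, which lies in \<open>R\<close> because \<open>b b\<^sup>*\<close> does. Conversely
  \<open>p' (b b\<^sub>0\<^sup>*) q' \<precsim> p q\<close> whenever \<open>p' \<precsim> p\<close> and \<open>q' \<precsim> q\<close>, and the left side is in \<open>R b b\<^sup>* R\<close> because
  \<open>b\<^sub>0\<^sup>* = b\<^sup>* (b b\<^sub>0\<^sup>*)\<close>.
\<close>

lemma section_source: "up E (set_star (coset_section b R) * coset_section b R) = R"
proof -
  have eq: "up E (set_star (coset_section b R) * coset_section b R)
      = up E (R * {b} * ({star b} * R))"
    using up_mult_up_left[OF round_star round_up, OF round_section round_section]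
      up_mult_up_right[OF round_star, OF round_section round_section]
    by (simp add: coset_section_def set_star_up set_star_mult unit_star star_star)
  have "R * {b} * ({star b} * R) \<subseteq> R"
  proof
    fix x assume "x \<in> R * {b} * ({star b} * R)"
    then obtain p q where "p \<in> R" "q \<in> R" "x = p * (b * star b) * q"
      by (auto elim!: set_times_elim simp: mult.assoc)
    then show "x \<in> R"
      by (simp add: unit_mult mult_star_in_unit)
  qed
  then have "up E (R * {b} * ({star b} * R)) \<subseteq> R"
    using up_mono up_coset[OF R] by blast
  moreover have "R * R \<subseteq> up E (R * {b} * ({star b} * R))"
  proof
    fix x assume "x \<in> R * R"
    then obtain p q where pq: "p \<in> R" "q \<in> R" "x = p * q"
      by (auto elim!: set_times_elim)
    then obtain p' q' where pq': "p' \<in> R" "q' \<in> R" "below E p' p" "below E q' q"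
      using coset_below[OF R] by blast
    have "p' * b * (star b * (b * star b0 * q')) \<in> R * {b} * ({star b} * R)"
      by (intro set_times_intro unit_mult star_below_mult_in_unit pq') simp_all
    then have "p' * (b * star b0 * q') \<in> R * {b} * ({star b} * R)"
      by (metis mult.assoc below_star_factor[OF b])
    moreover have "b * star b0 \<in> E"
      using star_in_E[OF below_mult_star_in_E] by (simp add: star_mult star_star)
    ultimately show "x \<in> up E (R * {b} * ({star b} * R))"
      unfolding pq(3) using pq' by (auto simp: up_def intro: below_mult below_left_multiple)
  qed
  then have "R \<subseteq> up E (R * {b} * ({star b} * R))"
    using up_least unit_up_mult by metis
  ultimately show ?thesis
    using eq by blast
qed

end

text \<open>
  Uniqueness of the arrow with a given source through a given element. For \<open>t \<precsim> w\<close> in \<open>B\<close>, the product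
  \<open>(b\<^sub>0\<^sup>* b) t\<^sup>*\<close> is still below \<open>w\<^sup>*\<close>, and it lies in \<open>b\<^sup>* (B B\<^sup>*)\<close> because \<open>b\<^sub>0\<^sup>* = b\<^sup>* (b b\<^sub>0\<^sup>*)\<close>.
\<close>

lemma section_range:
  assumes B: "B \<in> nonempty_cosets E" and b: "b \<in> B" "b0 \<in> B" "below E b0 b"
  shows "coset_section b (up E (B * set_star B)) = set_star B"
proof
  have "{star b} * up E (B * set_star B) \<subseteq> set_star B * up E (B * set_star B)"
    using b(1) by (intro set_times_mono2) auto
  then have "coset_section b (up E (B * set_star B)) \<subseteq> up E (set_star B * up E (B * set_star B))"
    unfolding coset_section_def by (rule up_mono)
  also have "\<dots> = set_star B"
    using up_coset_triple[OF coset_star[OF B]]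
    by (simp add: up_mult_up_right round_simps B set_star_star mult.assoc)
  finally show "coset_section b (up E (B * set_star B)) \<subseteq> set_star B" .
  show "set_star B \<subseteq> coset_section b (up E (B * set_star B))"
  proof
    fix x assume "x \<in> set_star B"
    then obtain w where w: "w \<in> B" "x = star w"
      by blast
    then obtain t where t: "t \<in> B" "below E t w"
      using coset_below[OF B] by blast
    have b0: "star b * b * star b0 = star b0"
      using below_star_factor[OF b(3)] by (simp add: mult.assoc)
    have "b * star b0 * b * star t \<in> B * set_star B"
      using coset_triple[OF B b(1,2,1)] t(1) by auto
    then have "b * star b0 * b * star t \<in> up E (B * set_star B)"
      using round_mult[OF round_coset round_star_coset, OF B B] by (auto simp: round_set_def)
    then have "star b * (b * star b0 * b * star t) \<in> {star b} * up E (B * set_star B)"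
      by blast
    then have "star b0 * b * star t \<in> {star b} * up E (B * set_star B)"
      using b0 by (metis mult.assoc)
    moreover have "star b0 * b \<in> E"
      using below_star[OF b(3)] by (simp add: below_def star_star)
    then have "below E (star b0 * b * star t) x"
      unfolding w(2) by (intro below_left_multiple below_star t)
    ultimately show "x \<in> coset_section b (up E (B * set_star B))"
      by (auto simp: coset_section_def up_def)
  qed
qed

section \<open>Continuity\<close>

lemma openin_containing: "openin (coset_topology E) {C \<in> nonempty_cosets E. a \<in> C}"
  unfolding coset_topology_def by (intro topology_generated_by_Basis) blast

lemma topspace_coset_topology: "topspace (coset_topology E) = nonempty_cosets E"
  using coset_nonempty by (force simp: coset_topology_def topology_generated_by_topspace)

lemma continuous_map_to_cosets:
  assumes "f ` topspace Y \<subseteq> nonempty_cosets E"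
    and "\<And>a. openin Y {y \<in> topspace Y. a \<in> f y}"
  shows "continuous_map Y (coset_topology E) f"
  unfolding coset_topology_def
proof (intro continuous_on_generated_topo)
  fix U assume "U \<in> range (\<lambda>a. {C \<in> nonempty_cosets E. a \<in> C})"
  then obtain a where "U = {C \<in> nonempty_cosets E. a \<in> C}"
    by blast
  then have "f -` U \<inter> topspace Y = {y \<in> topspace Y. a \<in> f y}"
    using assms(1) by auto
  then show "openin Y (f -` U \<inter> topspace Y)"
    using assms(2) by simp
next
  show "f ` topspace Y \<subseteq> \<Union> (range (\<lambda>a. {C \<in> nonempty_cosets E. a \<in> C}))"
    using assms(1) coset_nonempty by fastforce
qed

lemma continuous_map_star: "continuous_map (coset_topology E) (coset_topology E) set_star"
proof (rule continuous_map_to_cosets)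
  show "set_star ` topspace (coset_topology E) \<subseteq> nonempty_cosets E"
    by (auto simp: topspace_coset_topology intro: coset_star)
  have "a \<in> set_star C \<longleftrightarrow> star a \<in> C" for a :: 'a and C
    by (metis imageE imageI star_star)
  then show "openin (coset_topology E) {C \<in> topspace (coset_topology E). a \<in> set_star C}" for a
    using openin_containing by (simp add: topspace_coset_topology)
qed

lemma continuous_map_coset_mult:
  "continuous_map (subtopology (prod_topology (coset_topology E) (coset_topology E))
      (coset_composable E)) (coset_topology E) (\<lambda>(B, C). coset_mult E B C)"
  (is "continuous_map ?Y _ _")
proof (rule continuous_map_to_cosets)
  have Y: "topspace ?Y = coset_composable E"
    using composable_cosets by (auto simp: topspace_coset_topology)
  then show "(\<lambda>(B, C). coset_mult E B C) ` topspace ?Y \<subseteq> nonempty_cosets E"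
    by (auto simp: coset_mult_def intro: composable_mult_coset)
  fix a
  let ?N = "\<lambda>a. {C \<in> nonempty_cosets E. a \<in> C}"
  have "{y \<in> topspace ?Y. a \<in> (\<lambda>(B, C). coset_mult E B C) y}
      = (\<Union>(b, c) \<in> {(b, c). below E (b * c) a}. ?N b \<times> ?N c) \<inter> coset_composable E"
    unfolding Y using composable_cosets
    by (auto simp: coset_mult_def mem_up_mult) blast+
  moreover have "openin (prod_topology (coset_topology E) (coset_topology E))
      (\<Union>(b, c) \<in> {(b, c). below E (b * c) a}. ?N b \<times> ?N c)"
    by (intro openin_Union) (auto simp: openin_prod_Times_iff openin_containing)
  ultimately show "openin ?Y {y \<in> topspace ?Y. a \<in> (\<lambda>(B, C). coset_mult E B C) y}"
    by (auto simp: openin_subtopology)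
qed

lemma continuous_map_section:
  assumes b: "below E b0 b"
  shows "continuous_map (subtopology (coset_topology E) {R \<in> nonempty_cosets E. b0 * star b \<in> R})
    (coset_topology E) (coset_section b)" (is "continuous_map ?Y _ _")
proof (rule continuous_map_to_cosets)
  have Y: "topspace ?Y = {R \<in> nonempty_cosets E. b0 * star b \<in> R}"
    by (auto simp: topspace_coset_topology)
  then show "coset_section b ` topspace ?Y \<subseteq> nonempty_cosets E"
    using section_coset[OF b] by auto
  fix a
  have "{R \<in> topspace ?Y. a \<in> coset_section b R}
      = (\<Union>r \<in> {r. below E (star b * r) a}. {R \<in> nonempty_cosets E. r \<in> R})
          \<inter> {R \<in> nonempty_cosets E. b0 * star b \<in> R}"
    unfolding Y by (auto simp: coset_section_def mem_up_mult)
  moreover have "openin (coset_topology E)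
      (\<Union>r \<in> {r. below E (star b * r) a}. {R \<in> nonempty_cosets E. r \<in> R})"
    by (intro openin_Union) (auto simp: openin_containing)
  ultimately show "openin ?Y {R \<in> topspace ?Y. a \<in> coset_section b R}"
    by (auto simp: openin_subtopology)
qed

lemma topological_groupoid_cosets:
  "topological_groupoid (nonempty_cosets E) (coset_composable E) (coset_mult E) set_star
     (coset_topology E)"
  by (intro topological_groupoid.intro groupoid_cosets topological_groupoid_axioms.intro
      topspace_coset_topology continuous_map_star continuous_map_coset_mult)

end

section \<open>Open products from local sections\<close>

text \<open>
  Near \<open>f p\<close> with \<open>p \<in> W\<close>, the preimage of \<open>W\<close> under the right inverse is an open subset of \<open>f ` W\<close>.
\<close>

lemma open_map_if_local_sections:
  assumes f: "f ` topspace Y \<subseteq> topspace X"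
    and sections: "\<And>p. p \<in> topspace Y \<Longrightarrow>
      \<exists>N \<sigma>. openin X N \<and> f p \<in> N \<and> continuous_map (subtopology X N) Y \<sigma> \<and> \<sigma> (f p) = p
        \<and> (\<forall>x\<in>N. f (\<sigma> x) = x)"
  shows "open_map Y X f"
  unfolding open_map_def
proof (intro allI impI)
  fix W assume W: "openin Y W"
  show "openin X (f ` W)"
  proof (subst openin_subopen, intro ballI)
    fix x assume "x \<in> f ` W"
    then obtain p where p: "p \<in> W" "x = f p"
      by blast
    then have "p \<in> topspace Y"
      using openin_subset[OF W] by blast
    then obtain N \<sigma> where N: "openin X N" "f p \<in> N" "continuous_map (subtopology X N) Y \<sigma>"
      "\<sigma> (f p) = p" "\<And>x. x \<in> N \<Longrightarrow> f (\<sigma> x) = x"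
      using sections by metis
    let ?V = "{x \<in> topspace (subtopology X N). \<sigma> x \<in> W}"
    have "openin X ?V"
      using openin_continuous_map_preimage[OF N(3) W] N(1) openin_trans_full by blast
    moreover have "x \<in> ?V"
      using p N openin_subset[OF N(1)] by auto
    moreover have "?V \<subseteq> f ` W"
      using N(5) by force
    ultimately show "\<exists>T. openin X T \<and> x \<in> T \<and> T \<subseteq> f ` W"
      by blast
  qed
qed

context groupoid
begin

text \<open>
  Composability is primitive in the groupoid axioms; this recovers its description by sources and
  ranges. The common unit \<open>u\<close> is composable with both arrows, and \<open>g u = g\<close>.
\<close>

lemma composable_if_source_eq_range:
  assumes "g \<in> G" "h \<in> G" "m (i g) g = m h (i h)"
  shows "(g, h) \<in> G2"
proof -
  have g: "(i g, g) \<in> G2" "(g, i g) \<in> G2" and h: "(i h, h) \<in> G2" "(h, i h) \<in> G2"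
    using i_composable[of g] i_composable[of "i g"] i_composable[of h] i_composable[of "i h"]
      assms i_closed i_i by auto
  have "(g, m (i g) g) \<in> G2" "(m (i g) g, h) \<in> G2"
    using assoc_composable_right[OF g(2,1)] assoc_composable_left[OF h(2,1)] assms(3) by auto
  then have "(m g (m (i g) g), h) \<in> G2"
    by (rule assoc_composable_left)
  then show ?thesis
    using cancel_left[OF g(1)] i_i assms(1) by simp
qed

lemma range_mult:
  assumes gh: "(g, h) \<in> G2"
  shows "m (m g h) (i (m g h)) = m g (i g)"
proof -
  have g: "g \<in> G"
    using gh composable_subset by blast
  have ig: "(i g, g) \<in> G2" "(g, i g) \<in> G2"
    using i_composable[of g] i_composable[of "i g"] g i_closed i_i by auto
  have k: "(i g, m g h) \<in> G2"
    by (rule assoc_composable_right[OF ig(1) gh])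
  have "m (m g (i g)) (m g h) = m g h"
    using assoc[OF ig(2) k] cancel_left[OF gh] by simp
  then show ?thesis
    using cancel_right[OF assoc_composable_left[OF ig(2) k]] by simp
qed

end

context topological_groupoid
begin

lemma continuous_map_range: "continuous_map X X (\<lambda>g. m g (i g))"
proof -
  have "(g, i g) \<in> G2" if "g \<in> G" for g
    using i_composable[OF i_closed[OF that]] i_i[OF that] by simp
  then have "continuous_map X (subtopology (prod_topology X X) G2) (\<lambda>g. (g, i g))"
    using continuous_inverse
    by (auto simp: continuous_map_in_subtopology continuous_map_paired topspace_eq)
  from continuous_map_compose[OF this continuous_product] show ?thesis
    by (simp add: o_def)
qed

lemma open_map_product_if_local_sections:
  assumes "\<And>g. g \<in> G \<Longrightarrow>
    \<exists>N s. openin X N \<and> m g (i g) \<in> N \<and> continuous_map (subtopology X N) X s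
      \<and> s (m g (i g)) = i g \<and> (\<forall>u\<in>N. m (i (s u)) (s u) = u)"
  shows "open_map (subtopology (prod_topology X X) G2) X (\<lambda>(g, h). m g h)"
proof (rule open_map_if_local_sections)
  let ?Y = "subtopology (prod_topology X X) G2"
  have Y: "topspace ?Y = G2"
    using composable_subset by (auto simp: topspace_eq)
  show "(\<lambda>(g, h). m g h) ` topspace ?Y \<subseteq> topspace X"
    unfolding Y using m_closed by (auto simp: topspace_eq)
  fix p assume "p \<in> topspace ?Y"
  then obtain g h where p: "p = (g, h)" and gh: "(g, h) \<in> G2"
    unfolding Y by (cases p) auto
  then have g: "g \<in> G"
    using composable_subset by blast
  obtain N s where N: "openin X N" "m g (i g) \<in> N" "continuous_map (subtopology X N) X s"
    "s (m g (i g)) = i g" "\<And>u. u \<in> N \<Longrightarrow> m (i (s u)) (s u) = u"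
    using assms[OF g] by blast
  (* k |-> (s(r k)^{-1}, s(r k) k) is a right inverse of the product, and s(r(g h)) = s(r g) = g^{-1}. *)
  define r where "r k = m k (i k)" for k
  define M where "M = {k \<in> topspace X. r k \<in> N}"
  define \<sigma> where "\<sigma> k = (i (s (r k)), m (s (r k)) k)" for k
  have r: "continuous_map X X r"
    unfolding r_def by (rule continuous_map_range)
  have M: "openin X M"
    unfolding M_def by (rule openin_continuous_map_preimage[OF r N(1)])
  have sk: "s (r k) \<in> G" "(s (r k), k) \<in> G2" "(i (s (r k)), s (r k)) \<in> G2" if "k \<in> M" for k
  proof -
    show "s (r k) \<in> G"
      using N(1,3) that openin_subset[OF N(1)]
      by (auto simp: M_def continuous_map_def topspace_eq Pi_iff)
    then show "(s (r k), k) \<in> G2" "(i (s (r k)), s (r k)) \<in> G2"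
      using N(5)[of "r k"] that i_composable
      by (auto intro!: composable_if_source_eq_range simp: M_def topspace_eq r_def)
  qed
  have rN: "continuous_map (subtopology X M) (subtopology X N) r"
    using r by (auto simp: continuous_map_in_subtopology M_def intro: continuous_map_from_subtopology)
  have s: "continuous_map (subtopology X M) X (\<lambda>k. s (r k))"
    using continuous_map_compose[OF rN N(3)] by (simp add: o_def)
  have "continuous_map (subtopology X M) ?Y (\<lambda>k. (s (r k), k))"
    using s sk(2) by (auto simp: continuous_map_in_subtopology continuous_map_paired
        continuous_map_from_subtopology)
  from continuous_map_compose[OF this continuous_product]
  have "continuous_map (subtopology X M) X (\<lambda>k. m (s (r k)) k)"
    by (simp add: o_def)
  moreover have "continuous_map (subtopology X M) X (\<lambda>k. i (s (r k)))"
    using continuous_map_compose[OF s continuous_inverse] by (simp add: o_def)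
  ultimately have "continuous_map (subtopology X M) ?Y \<sigma>"
    using assoc_composable_right[OF sk(3,2)] unfolding \<sigma>_def
    by (auto simp: continuous_map_in_subtopology continuous_map_paired)
  moreover have rgh: "r (m g h) = m g (i g)"
    unfolding r_def by (rule range_mult[OF gh])
  then have "m g h \<in> M"
    using N(2) m_closed[OF gh] by (simp add: M_def topspace_eq)
  moreover have "\<sigma> (m g h) = (g, h)"
    using cancel_left[OF gh] i_i[OF g] by (simp add: \<sigma>_def rgh N(4))
  moreover have "m (i (s (r k))) (m (s (r k)) k) = k" if "k \<in> M" for k
    by (rule cancel_left[OF sk(2)[OF that]])
  ultimately show "\<exists>N \<sigma>. openin X N \<and> (\<lambda>(g, h). m g h) p \<in> N \<and> continuous_map (subtopology X N) ?Y \<sigma>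
      \<and> \<sigma> ((\<lambda>(g, h). m g h) p) = p \<and> (\<forall>x\<in>N. (\<lambda>(g, h). m g h) (\<sigma> x) = x)"
    using M unfolding p by (intro exI[of _ M] exI[of _ \<sigma>]) (simp add: \<sigma>_def)
qed

end

section \<open>The coset groupoid is etale\<close>

theorem theorem2p34:
  fixes E :: "'a::star_semigroup set"
  assumes "weyl_star_semigroup E"
  shows "etale_groupoid (nonempty_cosets E) (coset_composable E) (coset_mult E) set_star
           (coset_topology E)"
proof -
  interpret weyl_star_semigroup E
    by (rule assms)
  interpret topological_groupoid "nonempty_cosets E" "coset_composable E" "coset_mult E" set_star
    "coset_topology E"
    by (rule topological_groupoid_cosets)
  show ?thesis
  proof
    show "openin (coset_topology E) units"
      unfolding coset_units by (intro openin_Union) (auto simp: openin_containing)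
    show "open_map (subtopology (prod_topology (coset_topology E) (coset_topology E))
        (coset_composable E)) (coset_topology E) (\<lambda>(B, C). coset_mult E B C)"
    proof (rule open_map_product_if_local_sections)
      fix B assume B: "B \<in> nonempty_cosets E"
      then obtain b b0 where b: "b \<in> B" "b0 \<in> B" "below E b0 b"
        using coset_nonempty coset_below by blast
      let ?N = "{R \<in> nonempty_cosets E. b0 * star b \<in> R}"
      have "b0 * star b \<in> up E (B * set_star B)"
        using round_mult[OF round_coset round_star_coset, OF B B] b(1,2) by (auto simp: round_set_def)
      moreover have "up E (B * set_star B) \<in> nonempty_cosets E"
        using m_closed[OF i_composable[OF i_closed[OF B]]] by (simp add: coset_mult_def i_i[OF B])
      ultimately show "\<exists>N s. openin (coset_topology E) N \<and> coset_mult E B (set_star B) \<in> N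
          \<and> continuous_map (subtopology (coset_topology E) N) (coset_topology E) s
          \<and> s (coset_mult E B (set_star B)) = set_star B
          \<and> (\<forall>R\<in>N. coset_mult E (set_star (s R)) (s R) = R)"
        using openin_containing continuous_map_section[OF b(3)] section_range[OF B b]
          section_source[OF b(3)]
        by (intro exI[of _ ?N] exI[of _ "coset_section b"]) (simp add: coset_mult_def)
    qed
  qed
qed

end
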